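(* Let $\mathcal K$ be a real Hilbert space, let $\Psi\in C^1(\mathcal K)$ be a continuously (Fréchet) differentiable real-valued function on all of $\mathcal K$, and let $T=\nabla\Psi:\mathcal K\to\mathcal K$. Then for any closed linear subspaces $M,N\subset\mathcal K$, $$M\not\rightsquigarrow_T N\quad\Longleftrightarrow\quad N\not\rightsquigarrow_T M .$$
   Context: For a closed linear subspace $M\subset\mathcal K$, $P_M$ denotes the orthogonal projection onto $M$. For a map $T:\mathcal K\to\mathcal K$ and closed linear subspaces $M,N\subset\mathcal K$ (no relation between $M$ and $N$ is assumed), write $M\not\rightsquigarrow_T N$ (absence of influence of $M$ on $N$) if $P_NT(x+h)=P_NT(x)$ for all $x\in\mathcal K$ and all $h\in M$. *)

theory Defs
  imports "HOL-Analysis.Analysis"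
begin

text \<open>A real Hilbert space is a type of sort \<open>{real_inner, complete_space}\<close>.\<close>

text \<open>The orthogonal projection of \<open>x\<close> onto \<open>M\<close> is the unique \<open>p \<in> M\<close> with \<open>x - p\<close> orthogonal
  to \<open>M\<close>. It exists and is unique for a closed subspace of a Hilbert space (projection theorem);
  for other \<open>M\<close> the value is unspecified.\<close>

definition orth_proj :: "'a::real_inner set \<Rightarrow> 'a \<Rightarrow> 'a" where
  "orth_proj M x = (THE p. p \<in> M \<and> (\<forall>m\<in>M. orthogonal (x - p) m))"

definition no_influence ::
    "('a::real_inner \<Rightarrow> 'a) \<Rightarrow> 'a set \<Rightarrow> 'a set \<Rightarrow> bool" where
  "no_influence T M N \<longleftrightarrow>
     (\<forall>x. \<forall>h\<in>M. orth_proj N (T (x + h)) = orth_proj N (T x))"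

text \<open>The Frechet derivative is required to be continuous in the operator norm.\<close>

definition continuously_frechet_differentiable ::
    "('a::real_normed_vector \<Rightarrow> 'b::real_normed_vector) \<Rightarrow> bool" where
  "continuously_frechet_differentiable f \<longleftrightarrow>
     (\<exists>f' :: 'a \<Rightarrow> 'a \<Rightarrow>\<^sub>L 'b.
        (\<forall>x. (f has_derivative blinfun_apply (f' x)) (at x)) \<and> continuous_on UNIV f')"

end

theory Submission
  imports Defs
begin

text \<open>
  The absence of influence is a statement about \<open>\<Psi>\<close> that is visibly symmetric in \<open>M\<close> and \<open>N\<close>.
  Two vectors have the same projection onto \<open>N\<close> exactly when their difference is orthogonal to
  \<open>N\<close>, so \<open>M\<close> has no influence on \<open>N\<close> iff \<open>(T (x + h) - T x) \<bullet> k = 0\<close> for all \<open>x\<close>, \<open>h \<in> M\<close>,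
  \<open>k \<in> N\<close>. Since \<open>T\<close> is the gradient of \<open>\<Psi>\<close>, this number is the derivative at \<open>x\<close> in the direction
  \<open>k\<close> of the increment \<open>\<lambda>z. \<Psi> (z + h) - \<Psi> z\<close>. Its vanishing everywhere means that the increment
  is constant along \<open>N\<close>, that is,
  \<open>\<Psi> (x + h + k) - \<Psi> (x + k) = \<Psi> (x + h) - \<Psi> x\<close>. This four-point identity is unchanged when
  \<open>h\<close> and \<open>k\<close> are exchanged (\<open>no_influence_iff_mixed_difference\<close>). The argument works with
  first differences of \<open>\<Psi>\<close> in place of the symmetric Hessian that a twice differentiable \<open>\<Psi>\<close>
  would have.

  The translation of projections into orthogonality rests on the projection theorem,
  without which \<open>orth_proj\<close> would be an arbitrary value
  (\<open>orthogonal_projection_exists\<close>).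
\<close>

text \<open>The classical minimisation argument. The near-minimisers of the distance from \<open>x\<close>
  form nested closed sets, whose diameters tend to 0 by the parallelogram law because the
  midpoint of two of them still lies in \<open>N\<close>; completeness yields a common point, the nearest point,
  and the first-order condition at it is orthogonality.\<close>

lemma orthogonal_projection_exists:
  fixes N :: "'a::{real_inner, complete_space} set"
  assumes N: "subspace N" "closed N"
  shows "\<exists>p\<in>N. \<forall>m\<in>N. orthogonal (x - p) m"
proof -
  define q where "q y = (norm (x - y))\<^sup>2" for y
  define D where "D = (INF y\<in>N. q y)"
  define S where "S n = {y \<in> N. q y \<le> D + 1 / real (Suc n)}" for n
  have ne: "N \<noteq> {}" using subspace_0[OF N(1)] by auto
  have bdd: "bdd_below (q ` N)" by (rule bdd_belowI[of _ 0]) (auto simp: q_def)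
  have D_le: "D \<le> q y" if "y \<in> N" for y
    unfolding D_def using bdd that by (rule cINF_lower)
  have "\<exists>l. \<forall>n. l \<in> S n"
  proof (rule decreasing_closed_nest)
    show "closed (S n)" for n
    proof -
      have "S n = N \<inter> {y. q y \<le> D + 1 / real (Suc n)}" by (auto simp: S_def)
      moreover have "closed {y. q y \<le> D + 1 / real (Suc n)}"
        unfolding q_def by (intro closed_Collect_le continuous_intros)
      ultimately show ?thesis using N(2) by auto
    qed
    show "S n \<noteq> {}" for n
    proof -
      have "D < D + 1 / real (Suc n)" by simp
      then obtain y where "y \<in> N" "q y < D + 1 / real (Suc n)"
        unfolding D_def using cINF_less_iff[OF ne bdd] by blast
      then show ?thesis by (auto simp: S_def intro!: exI[of _ y])
    qed
    show "S n \<subseteq> S m" if "m \<le> n" for m n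
    proof -
      have "1 / real (Suc n) \<le> 1 / real (Suc m)" using that by (simp add: frac_le)
      then show ?thesis by (auto simp: S_def)
    qed
    show "\<exists>n. \<forall>y\<in>S n. \<forall>z\<in>S n. dist y z < e" if "e > 0" for e
    proof -
      obtain n where n: "1 / real (Suc n) < e\<^sup>2 / 4"
        using reals_Archimedean[of "e\<^sup>2 / 4"] \<open>e > 0\<close> by (auto simp: inverse_eq_divide)
      have "dist y z < e" if "y \<in> S n" "z \<in> S n" for y z
      proof -
        have "(1/2) *\<^sub>R (y + z) \<in> N"
          using that N(1) by (auto simp: S_def intro!: subspace_scale subspace_add)
        then have "D \<le> q ((1/2) *\<^sub>R (y + z))" by (rule D_le)
        moreover have "(dist y z)\<^sup>2 = 2 * q y + 2 * q z - 4 * q ((1/2) *\<^sub>R (y + z))"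
          unfolding q_def dist_norm power2_norm_eq_inner
          by (simp add: inner_simps inner_commute algebra_simps)
        moreover have "q y \<le> D + 1 / real (Suc n)" "q z \<le> D + 1 / real (Suc n)"
          using that by (auto simp: S_def)
        ultimately have "(dist y z)\<^sup>2 < e\<^sup>2" using n by linarith
        then show ?thesis using \<open>e > 0\<close> by (simp add: power2_less_imp_less)
      qed
      then show ?thesis by blast
    qed
  qed blast
  then obtain p where p: "p \<in> S n" for n by blast
  then have pN: "p \<in> N" by (auto simp: S_def)
  have "q p \<le> D"
  proof (rule field_le_epsilon)
    fix e :: real assume "e > 0"
    then obtain n where "1 / real (Suc n) < e"
      using reals_Archimedean[of e] by (auto simp: inverse_eq_divide)
    moreover have "q p \<le> D + 1 / real (Suc n)" using p[of n] by (simp add: S_def)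
    ultimately show "q p \<le> D + e" by linarith
  qed
  have "(x - p) \<bullet> m = 0" if m: "m \<in> N" for m
  proof (cases "m = 0")
    case False
    \<comment> \<open>Compare \<open>p\<close> with \<open>p + t *\<^sub>R m\<close> for the \<open>t\<close> that minimises the distance on this line.\<close>
    define t where "t = ((x - p) \<bullet> m) / (m \<bullet> m)"
    have mm: "m \<bullet> m > 0" using False by simp
    have "p + t *\<^sub>R m \<in> N" using pN m N(1) by (intro subspace_add subspace_scale)
    then have "q p \<le> q (p + t *\<^sub>R m)" using \<open>q p \<le> D\<close> D_le by fastforce
    also have "\<dots> = q p - 2 * t * ((x - p) \<bullet> m) + t * t * (m \<bullet> m)"
      unfolding q_def power2_norm_eq_inner by (simp add: inner_simps inner_commute algebra_simps)
    also have "\<dots> = q p - ((x - p) \<bullet> m)\<^sup>2 / (m \<bullet> m)"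
      using mm by (simp add: t_def power2_eq_square field_simps)
    finally have "((x - p) \<bullet> m)\<^sup>2 / (m \<bullet> m) \<le> 0" by simp
    then show ?thesis using mm by (simp add: divide_le_0_iff)
  qed simp
  then show ?thesis using pN by (auto simp: orthogonal_def)
qed

lemma orth_proj_unique:
  fixes N :: "'a::real_inner set"
  assumes "subspace N" "p \<in> N" "\<And>m. m \<in> N \<Longrightarrow> orthogonal (x - p) m"
  shows "orth_proj N x = p"
  unfolding orth_proj_def
proof (rule the_equality)
  fix r assume r: "r \<in> N \<and> (\<forall>m\<in>N. orthogonal (x - r) m)"
  have "r - p \<in> N" using r assms by (simp add: subspace_diff)
  then have "(x - p) \<bullet> (r - p) = 0" "(x - r) \<bullet> (r - p) = 0"
    using r assms by (auto simp: orthogonal_def)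
  then have "(r - p) \<bullet> (r - p) = 0" by (simp add: inner_diff_left)
  then show "r = p" by simp
qed (use assms in auto)

lemma orth_proj_eq_iff:
  fixes N :: "'a::{real_inner, complete_space} set"
  assumes N: "subspace N" "closed N"
  shows "orth_proj N u = orth_proj N v \<longleftrightarrow> (\<forall>k\<in>N. (u - v) \<bullet> k = 0)"
proof -
  obtain p where p: "p \<in> N" "\<forall>m\<in>N. orthogonal (u - p) m"
    using orthogonal_projection_exists[OF N] by blast
  obtain r where r: "r \<in> N" "\<forall>m\<in>N. orthogonal (v - r) m"
    using orthogonal_projection_exists[OF N] by blast
  have pr: "orth_proj N u = p" "orth_proj N v = r"
    using p r N(1) by (auto intro: orth_proj_unique)
  show ?thesis
  proof
    assume "orth_proj N u = orth_proj N v"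
    then show "\<forall>k\<in>N. (u - v) \<bullet> k = 0"
      using p r pr by (auto simp: orthogonal_def inner_diff_left)
  next
    assume "\<forall>k\<in>N. (u - v) \<bullet> k = 0"
    then have "orthogonal (v - p) m" if "m \<in> N" for m
      using p that by (auto simp: orthogonal_def inner_diff_left)
    then show "orth_proj N u = orth_proj N v"
      using p(1) pr N(1) orth_proj_unique by metis
  qed
qed

lemma GDERIV_imp_directional_derivative:
  fixes f :: "'a::real_inner \<Rightarrow> real"
  assumes "GDERIV f (x + t *\<^sub>R k) :> g"
  shows "((\<lambda>s. f (x + s *\<^sub>R k)) has_real_derivative g \<bullet> k) (at t)"
proof -
  have f: "(f has_derivative (\<lambda>h. h \<bullet> g)) (at (x + t *\<^sub>R k))"
    using assms by (simp add: gderiv_def)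
  have "((\<lambda>s. x + s *\<^sub>R k) has_derivative (\<lambda>s. s *\<^sub>R k)) (at t)"
    by (auto intro!: derivative_eq_intros)
  from has_derivative_compose[OF this f]
  show ?thesis
    by (simp add: has_field_derivative_def inner_commute mult.commute[of _ "g \<bullet> k"])
qed

text \<open>For a fixed \<open>h\<close>, the left-hand side says that the increment of \<open>\<Psi>\<close> along \<open>h\<close> has vanishing
  derivative in the directions of \<open>N\<close>, the right-hand side that it is constant along \<open>N\<close>. The point
  of this form is that the right-hand side treats \<open>h\<close> and \<open>k\<close> alike.\<close>

lemma gradient_increment_orthogonal_iff:
  fixes \<Psi> :: "'a::real_inner \<Rightarrow> real"
  assumes grad: "\<And>x. GDERIV \<Psi> x :> T x" and N: "subspace N"
  shows "(\<forall>x. \<forall>k\<in>N. (T (x + h) - T x) \<bullet> k = 0) \<longleftrightarrow>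
         (\<forall>x. \<forall>k\<in>N. \<Psi> (x + h + k) - \<Psi> (x + h) - \<Psi> (x + k) + \<Psi> x = 0)"
    (is "?L \<longleftrightarrow> ?R")
proof -
  define \<phi> where "\<phi> x k s = \<Psi> (x + h + s *\<^sub>R k) - \<Psi> (x + s *\<^sub>R k)" for x k s
  have deriv: "(\<phi> x k has_real_derivative (T (x + t *\<^sub>R k + h) - T (x + t *\<^sub>R k)) \<bullet> k) (at t)"
    for x k t
    unfolding \<phi>_def inner_diff_left
    using DERIV_diff[OF GDERIV_imp_directional_derivative[OF grad, where x = "x + h" and t = t and k = k]
        GDERIV_imp_directional_derivative[OF grad, where x = x and t = t and k = k]]
    by (simp add: add_ac)
  show ?thesis
  proof
    assume L: ?L
    show ?R
    proof (intro allI ballI)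
      fix x k assume "k \<in> N"
      then have "(\<phi> x k has_real_derivative 0) (at t)" for t
        using deriv[of x k t] L by simp
      then have "\<phi> x k 1 = \<phi> x k 0" by (intro DERIV_isconst_all) auto
      then show "\<Psi> (x + h + k) - \<Psi> (x + h) - \<Psi> (x + k) + \<Psi> x = 0"
        by (simp add: \<phi>_def)
    qed
  next
    assume R: ?R
    show ?L
    proof (intro allI ballI)
      fix x k assume k: "k \<in> N"
      have "\<phi> x k s = \<Psi> (x + h) - \<Psi> x" for s
        using R[rule_format, of "s *\<^sub>R k" x] subspace_scale[OF N k, of s] by (simp add: \<phi>_def)
      then have "\<phi> x k = (\<lambda>s. \<Psi> (x + h) - \<Psi> x)" by blast
      then have "(\<phi> x k has_real_derivative 0) (at 0)" by simp
      then show "(T (x + h) - T x) \<bullet> k = 0"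
        using DERIV_unique[OF deriv[of x k 0]] by simp
    qed
  qed
qed

lemma no_influence_iff_mixed_difference:
  fixes \<Psi> :: "'a::{real_inner, complete_space} \<Rightarrow> real"
  assumes grad: "\<And>x. GDERIV \<Psi> x :> T x" and N: "subspace N" "closed N"
  shows "no_influence T M N \<longleftrightarrow>
    (\<forall>h\<in>M. \<forall>k\<in>N. \<forall>x. \<Psi> (x + h + k) - \<Psi> (x + h) - \<Psi> (x + k) + \<Psi> x = 0)"
proof -
  have "no_influence T M N \<longleftrightarrow> (\<forall>h\<in>M. \<forall>x. \<forall>k\<in>N. (T (x + h) - T x) \<bullet> k = 0)"
    unfolding no_influence_def orth_proj_eq_iff[OF N] by blast
  then show ?thesis
    unfolding gradient_increment_orthogonal_iff[OF grad N(1)] by blast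
qed

theorem proposition3p2:
  fixes \<Psi> :: "'a::{real_inner, complete_space} \<Rightarrow> real"
    and T :: "'a \<Rightarrow> 'a"
    and M N :: "'a set"
  assumes "continuously_frechet_differentiable \<Psi>"
    and "\<And>x. GDERIV \<Psi> x :> T x"
    and "subspace M" and "closed M"
    and "subspace N" and "closed N"
  shows "no_influence T M N \<longleftrightarrow> no_influence T N M"
proof -
  have swap: "\<Psi> (x + h + k) - \<Psi> (x + h) - \<Psi> (x + k) + \<Psi> x =
              \<Psi> (x + k + h) - \<Psi> (x + k) - \<Psi> (x + h) + \<Psi> x" for x h k
    by (simp add: add_ac)
  show ?thesis
    unfolding no_influence_iff_mixed_difference[OF assms(2,5,6)]
      no_influence_iff_mixed_difference[OF assms(2,3,4)]
    using swap by metis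
qed

end
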